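(* Consider the noise-intervened Hegselmann–Krause system with an additional leader agent described in the context, with $n$ ordinary agents $\mathcal V=\{1,\dots,n\}$, confidence threshold $\epsilon>0$, divisive initial state, noise uniformly distributed on $[-\delta_1,\delta_2]$ with $0\le\delta_1\le\delta_2$, and leader opinion $A>x_{N_c}^*+\epsilon$. Suppose $0<\delta_2\le\frac{\epsilon}{2n}$. Let $d_{\mathcal V}^A(t)=\max_{i\in\mathcal V}|x_i(t)-A|$. Then almost surely $$\limsup_{t\to\infty}d_{\mathcal V}^A(t)\le 2\delta_2 .$$
   Context: Time $t\in\{0,1,2,\dots\}$ is discrete. Ordinary agents are $\mathcal V=\{1,\dots,n\}$, with opinions $x_i(t)\in\mathbb R$. There is one additional leader agent $l\notin\mathcal V$ whose opinion is constant: $x_l(t)=A$ for all $t\ge0$. The confidence threshold is $\epsilon>0$. The neighbor set of an ordinary agent $i\in\mathcal V$ is $\mathcal N_i(x(t))=\{j\in\mathcal V\cup\{l\}: |x_j(t)-x_i(t)|\le\epsilon\}$ (so the leader counts as a neighbor whenever its opinion is within $\epsilon$). Divisive initial state: $\mathcal V$ is partitioned into nonempty disjoint clusters $\mathcal V_1,\dots,\mathcal V_{N_c}$ with $2\le N_c\le n$; there are real numbers $x_1^*,\dots,x_{N_c}^*$ with $x_p^*-x_q^*>\epsilon$ for all $1\le q<p\le N_c$; and $x_i(0)=x_g^*$ for every $i\in\mathcal V_g$, $1\le g\le N_c$. Agent $1$ belongs to $\mathcal V_1$ (the cluster with the smallest opinion value). The leader's opinion satisfies $A>x_{N_c}^*+\epsilon$.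 Dynamics: for all $i\in\mathcal V$ and $t\ge0$, $$x_i(t+1)=\frac{1}{|\mathcal N_i(x(t))|}\sum_{j\in\mathcal N_i(x(t))}x_j(t)+I_{\{i=1\}}\,\xi(t+1),$$ where $I_{\{i=1\}}$ equals $1$ if $i=1$ and $0$ otherwise, and $\{\xi(t),t\ge1\}$ are independent random variables, each uniformly distributed on $[-\delta_1,\delta_2]$, with $0\le\delta_1\le\delta_2$. *)

theory Defs
  imports "HOL-Probability.Probability"
begin

text \<open>Ordinary agents are \<open>1, \<dots>, n\<close>; the leader \<open>l\<close> is any index outside that range.\<close>

definition neighbors :: "nat \<Rightarrow> nat \<Rightarrow> real \<Rightarrow> (nat \<Rightarrow> real) \<Rightarrow> nat \<Rightarrow> nat set" where
  "neighbors n l \<epsilon> y i = {j \<in> {1..n} \<union> {l}. \<bar>y j - y i\<bar> \<le> \<epsilon>}"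

definition divisive_state ::
  "nat \<Rightarrow> real \<Rightarrow> nat \<Rightarrow> (nat \<Rightarrow> nat set) \<Rightarrow> (nat \<Rightarrow> real) \<Rightarrow> (nat \<Rightarrow> real) \<Rightarrow> bool" where
  "divisive_state n \<epsilon> Nc V xs y \<longleftrightarrow>
     2 \<le> Nc \<and> Nc \<le> n \<and>
     (\<Union>g\<in>{1..Nc}. V g) = {1..n} \<and>
     disjoint_family_on V {1..Nc} \<and>
     (\<forall>g\<in>{1..Nc}. V g \<noteq> {}) \<and>
     (\<forall>p\<in>{1..Nc}. \<forall>q\<in>{1..Nc}. q < p \<longrightarrow> xs p - xs q > \<epsilon>) \<and>
     (\<forall>g\<in>{1..Nc}. \<forall>i\<in>V g. y i = xs g)"

text \<open>\<open>x t i \<omega>\<close> is the opinion of agent \<open>i\<close> at time \<open>t\<close>.\<close>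

definition HK_leader_dynamics ::
  "'a measure \<Rightarrow> nat \<Rightarrow> nat \<Rightarrow> real \<Rightarrow> real \<Rightarrow> (nat \<Rightarrow> 'a \<Rightarrow> real) \<Rightarrow> (nat \<Rightarrow> nat \<Rightarrow> 'a \<Rightarrow> real) \<Rightarrow> bool" where
  "HK_leader_dynamics M n l \<epsilon> A \<xi> x \<longleftrightarrow>
     (\<forall>\<omega>\<in>space M. \<forall>t.
        x t l \<omega> = A \<and>
        (\<forall>i\<in>{1..n}. x (Suc t) i \<omega> =
            (\<Sum>j\<in>neighbors n l \<epsilon> (\<lambda>k. x t k \<omega>) i. x t j \<omega>)
              / real (card (neighbors n l \<epsilon> (\<lambda>k. x t k \<omega>) i))
            + (if i = 1 then \<xi> (Suc t) \<omega> else 0)))"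

definition max_dist :: "nat \<Rightarrow> real \<Rightarrow> (nat \<Rightarrow> real) \<Rightarrow> real" where
  "max_dist n A y = (MAX i\<in>{1..n}. \<bar>y i - A\<bar>)"

end

theory Submission
  imports Defs
begin

text \<open>
  The lowest group contains agent 1, and while nobody outside is in sight its mean performs a random walk
  whose steps have nonnegative mean, so it is unbounded above. Hence agent 1 sooner or later
  sees the next cluster, and the bound on \<open>\<delta>2\<close> makes the two groups merge within two steps before either
  touches a further one. Once all agents form one group, being attracted by the leader only helps the random walk,
  so eventually everybody is within \<open>\<epsilon>\<close> of the leader. This is absorbing: from then on the excess over \<open>\<delta>2\<close>
  of the other agents' distance to the leader contracts by \<open>n / (n + 1)\<close>, and agent 1 is at most another
  \<open>\<delta>2\<close> away from them.
\<close>

subsection \<open>Partial sums of the noise\<close>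

text \<open>The density is strictly positive, so a tail of probability 0 would be Lebesgue null; but
  it contains an interval of length 1.\<close>

lemma std_normal_upper_tail_pos: "0 < measure std_normal_distribution {1<..}"
proof -
  interpret prob_space std_normal_distribution
    by (rule prob_space_normal_density) simp
  have "emeasure std_normal_distribution {1<..} \<noteq> 0"
  proof
    assume "emeasure std_normal_distribution {1<..} = 0"
    then have "AE x in lborel. x \<in> {1<..} \<longrightarrow> ennreal (std_normal_density x) = 0"
      by (subst (asm) emeasure_density) (auto simp: nn_integral_0_iff_AE indicator_def)
    then have "AE x in lborel. (x::real) \<notin> {1<..}"
      by eventually_elim (use normal_density_pos[of 1 0] in \<open>auto simp: less_le\<close>)
    then have "emeasure lborel {(1::real)<..} = 0"
      by (subst (asm) AE_iff_measurable[of "{1<..}"]) auto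
    moreover have "emeasure lborel {1<..<2::real} \<le> emeasure lborel {(1::real)<..}"
      by (intro emeasure_mono) auto
    ultimately show False by simp
  qed
  then show ?thesis
    by (simp add: emeasure_eq_measure zero_less_measure_iff)
qed

text \<open>What the central limit theorem requires at the point 1: weak convergence gives
  convergence of distribution functions only at continuity points, and the strict inequality leaves
  a positive limiting probability beyond 1.\<close>

lemma std_normal_cdf_1:
  "isCont (cdf std_normal_distribution) 1" "cdf std_normal_distribution 1 < 1"
proof -
  interpret N: real_distribution std_normal_distribution
    by (rule real_dist_normal_dist)
  have "emeasure std_normal_distribution {1} = 0"
    by (subst emeasure_density) (auto simp: nn_integral_0_iff_AE AE_lborel_singleton intro!: AE_mp[OF AE_lborel_singleton[of 1]] )
  then show "isCont (cdf std_normal_distribution) 1"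
    by (simp add: N.isCont_cdf measure_def)
  have "measure std_normal_distribution (UNIV - {1<..}) = 1 - measure std_normal_distribution {1<..}"
    using N.prob_compl[of "{1<..}"] by simp
  moreover have "UNIV - {1<..} = {..1::real}" by auto
  ultimately show "cdf std_normal_distribution 1 < 1"
    using std_normal_upper_tail_pos by (simp add: cdf_def)
qed

text \<open>By the central limit theorem the standardised sum exceeds 1 with limiting probability
  \<open>1 - cdf std_normal_distribution 1\<close>, so half of this is reached for all large
  lengths. The centred sum then exceeds its standard deviation, which outgrows any \<open>C\<close>,
  and \<open>0 \<le> m\<close> allows the centring to be dropped. The bound on the probability is
  independent of \<open>C\<close>.\<close>

lemma (in prob_space) prob_centred_sum_large:
  fixes X :: "nat \<Rightarrow> 'a \<Rightarrow> real"
  assumes "indep_vars (\<lambda>i. borel) X UNIV" "\<And>i. expectation (X i) = m" "\<sigma> > 0"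
    and "\<And>i. integrable M (\<lambda>\<omega>. (X i \<omega>)\<^sup>2)" "\<And>i. variance (X i) = \<sigma>\<^sup>2"
    and "\<And>i. distr M borel (X i) = \<mu>" "0 \<le> m"
  shows "\<exists>L. (1 - cdf std_normal_distribution 1) / 2 \<le> prob {\<omega>\<in>space M. C < (\<Sum>i<L. X i \<omega>)}"
proof -
  have [measurable]: "X i \<in> borel_measurable M" for i
    using assms(1) by (auto simp: indep_vars_def)
  define Z where "Z n \<omega> = (\<Sum>i<n. X i \<omega> - m) / sqrt (real n * \<sigma>\<^sup>2)" for n \<omega>
  let ?F = "cdf std_normal_distribution"
  have "weak_conv_m (\<lambda>n. distr M borel (Z n)) std_normal_distribution"
    unfolding Z_def using central_limit_theorem[OF assms(1-6)] .
  then have "(\<lambda>n. cdf (distr M borel (Z n)) 1) \<longlonglongrightarrow> ?F 1"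
    using std_normal_cdf_1(1) by (simp add: weak_conv_m_def weak_conv_def)
  moreover have "?F 1 < (1 + ?F 1) / 2" using std_normal_cdf_1(2) by simp
  ultimately have "eventually (\<lambda>n. cdf (distr M borel (Z n)) 1 < (1 + ?F 1) / 2) sequentially"
    by (rule order_tendstoD(2))
  moreover have "eventually (\<lambda>n. C < sqrt (real n * \<sigma>\<^sup>2)) sequentially"
    using \<open>\<sigma> > 0\<close> by real_asymp
  moreover have "eventually (\<lambda>n::nat. n > 0) sequentially" by (rule eventually_gt_at_top)
  ultimately obtain n where n: "cdf (distr M borel (Z n)) 1 < (1 + ?F 1) / 2"
      "C < sqrt (real n * \<sigma>\<^sup>2)" "n > 0"
    by (metis (mono_tags, lifting) eventually_conj eventually_sequentially order_refl)
  have [measurable]: "Z n \<in> borel_measurable M" unfolding Z_def by measurable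
  have "cdf (distr M borel (Z n)) 1 = prob {\<omega>\<in>space M. Z n \<omega> \<le> 1}"
    by (auto simp: cdf_def measure_distr intro!: arg_cong[where f=prob])
  then have "1 - prob {\<omega>\<in>space M. Z n \<omega> \<le> 1} \<ge> (1 - ?F 1) / 2" using n(1) by simp
  also have "1 - prob {\<omega>\<in>space M. Z n \<omega> \<le> 1} = prob {\<omega>\<in>space M. 1 < Z n \<omega>}"
    by (subst prob_compl[symmetric]) (auto intro!: arg_cong[where f=prob])
  also have "\<dots> \<le> prob {\<omega>\<in>space M. C < (\<Sum>i<n. X i \<omega>)}"
  proof (rule finite_measure_mono)
    show "{\<omega>\<in>space M. 1 < Z n \<omega>} \<subseteq> {\<omega>\<in>space M. C < (\<Sum>i<n. X i \<omega>)}"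
    proof safe
      fix \<omega> assume "1 < Z n \<omega>"
      then have "sqrt (real n * \<sigma>\<^sup>2) < (\<Sum>i<n. X i \<omega> - m)"
        using n(3) \<open>\<sigma> > 0\<close> by (simp add: Z_def less_divide_eq)
      also have "\<dots> \<le> (\<Sum>i<n. X i \<omega>)" using \<open>0 \<le> m\<close> by (intro sum_mono) auto
      finally show "C < (\<Sum>i<n. X i \<omega>)" using n(2) by simp
    qed
  qed measurable
  finally show ?thesis by blast
qed

text \<open>On a block long enough that its sum beats the a priori bound \<open>B N\<close> on everything before
  it with probability bounded below, the partial sum is large whatever happened earlier. Such blocks are
  independent, so the Borel 0-1 law makes infinitely many of them succeed.\<close>
lemma (in prob_space) AE_partial_sums_unbounded_above:
  fixes X :: "nat \<Rightarrow> 'a \<Rightarrow> real"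
  assumes indep: "indep_vars (\<lambda>i. borel) X {1..}"
    and mean: "\<And>i. i \<ge> 1 \<Longrightarrow> expectation (X i) = m" and "0 \<le> m"
    and "\<sigma> > 0" and var: "\<And>i. i \<ge> 1 \<Longrightarrow> variance (X i) = \<sigma>\<^sup>2"
    and distr: "\<And>i. i \<ge> 1 \<Longrightarrow> distr M borel (X i) = \<mu>"
    and bounded: "\<And>i. i \<ge> 1 \<Longrightarrow> AE \<omega> in M. \<bar>X i \<omega>\<bar> \<le> B"
  shows "AE \<omega> in M. \<forall>C. \<exists>t. C < (\<Sum>i\<in>{1..t}. X i \<omega>)"
proof -
  have X_rv: "X i \<in> borel_measurable M" if "i \<ge> 1" for i
    using indep that by (auto simp: indep_vars_def)
  define c where "c = (1 - cdf std_normal_distribution 1) / 2"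
  have "c > 0" using std_normal_cdf_1(2) by (simp add: c_def)
  have "\<exists>L. c \<le> prob {\<omega>\<in>space M. C < (\<Sum>i<L. X (Suc N + i) \<omega>)}" for C N
    unfolding c_def
  proof (rule prob_centred_sum_large)
    show "integrable M (\<lambda>\<omega>. (X (Suc N + i) \<omega>)\<^sup>2)" for i
    proof (rule integrable_const_bound)
      show "AE \<omega> in M. norm ((X (Suc N + i) \<omega>)\<^sup>2) \<le> B\<^sup>2"
        using bounded[of "Suc N + i"] by (auto simp: abs_le_square_iff[symmetric] elim!: eventually_mono)
      show "(\<lambda>\<omega>. (X (Suc N + i) \<omega>)\<^sup>2) \<in> borel_measurable M"
        using X_rv[of "Suc N + i"] by simp
    qed
    show "indep_vars (\<lambda>i. borel) (\<lambda>i. X (Suc N + i)) UNIV"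
    proof -
      \<comment> \<open>The index shift is obtained by grouping the family into the disjoint
        singletons \<open>{Suc N + i}\<close> and then evaluating each group at its only
        index.\<close>
      have "indep_vars (\<lambda>i. PiM {Suc N + i} (\<lambda>_. borel))
          (\<lambda>i \<omega>. restrict (\<lambda>j. X j \<omega>) {Suc N + i}) UNIV"
        by (rule indep_vars_restrict[OF indep]) (auto simp: disjoint_family_on_def)
      then have "indep_vars (\<lambda>i. borel)
          (\<lambda>i \<omega>. restrict (\<lambda>j. X j \<omega>) {Suc N + i} (Suc N + i)) UNIV"
        by (rule indep_vars_compose2[where Y="\<lambda>i f. f (Suc N + i)"]) measurable
      then show ?thesis by simp
    qed
  qed (use assms in auto)
  then obtain L where L: "c \<le> prob {\<omega>\<in>space M. C < (\<Sum>i<L C N. X (Suc N + i) \<omega>)}" for C N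
    by metis
  \<comment> \<open>\<open>T k\<close> is where block \<open>k\<close> starts; the recursion is
    forced because the block length depends on the start. In the threshold, \<open>B * T k\<close>
    offsets the worst case \<open>- B * T k\<close> of all earlier terms, and \<open>k\<close> makes
    what remains arbitrarily large.\<close>
  define T where "T = rec_nat 0 (\<lambda>k N. N + L (B * N + k) N)"
  have T: "T (Suc k) = T k + L (B * T k + k) (T k)" for k by (simp add: T_def)
  have T_mono: "T j \<le> T k" if "j \<le> k" for j k
    using that by (rule lift_Suc_mono_le[rotated]) (simp add: T)
  define P where "P k x \<longleftrightarrow> B * T k + k < (\<Sum>i\<in>{T k<..T (Suc k)}. x i)" for k and x :: "nat \<Rightarrow> real"
  have block: "(\<Sum>i\<in>{T k<..T (Suc k)}. X i \<omega>) = (\<Sum>i<L (B * T k + k) (T k). X (Suc (T k) + i) \<omega>)" for k \<omega>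
    unfolding T by (rule sum.reindex_bij_witness[of _ "\<lambda>i. Suc (T k) + i" "\<lambda>i. i - Suc (T k)"]) auto
  \<comment> \<open>Written with \<open>restrict\<close>, the event visibly depends on the
    coordinates of its own block only, which is the form that the independence rule matches.\<close>
  define F where "F k = {\<omega>\<in>space M. P k (restrict (\<lambda>i. X i \<omega>) {T k<..T (Suc k)})}" for k
  have F_eq: "F k = {\<omega>\<in>space M. B * T k + k < (\<Sum>i\<in>{T k<..T (Suc k)}. X i \<omega>)}" for k
    by (auto simp: F_def P_def cong: sum.cong_simp)
  have ind: "indep_events F UNIV" unfolding F_def
  proof (rule indep_eventsI_indep_vars[where P = P])
    show "indep_vars (\<lambda>k. PiM {T k<..T (Suc k)} (\<lambda>_. borel))
       (\<lambda>k \<omega>. restrict (\<lambda>i. X i \<omega>) {T k<..T (Suc k)}) UNIV"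
    proof (rule indep_vars_restrict[OF indep])
      show "disjoint_family (\<lambda>k. {T k<..T (Suc k)})"
        unfolding disjoint_family_on_def
      proof (intro ballI impI)
        fix j k :: nat assume "j \<noteq> k"
        then have "Suc j \<le> k \<or> Suc k \<le> j" by linarith
        then have "T (Suc j) \<le> T k \<or> T (Suc k) \<le> T j" using T_mono by blast
        then show "{T j<..T (Suc j)} \<inter> {T k<..T (Suc k)} = {}" by auto
      qed
    qed auto
    show "{x \<in> space (PiM {T k<..T (Suc k)} (\<lambda>_. borel)). P k x} \<in> sets (PiM {T k<..T (Suc k)} (\<lambda>_. borel))" for k
      unfolding P_def by measurable
  qed
  then have F_ev: "F k \<in> events" for k by (auto simp: indep_events_def)
  \<comment> \<open>Each tail union contains \<open>F n\<close>, hence has probability at least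
    \<open>c\<close>, and so has their decreasing limit. By the 0-1 law a positive probability must
    be 1.\<close>
  have "c \<le> prob (\<Inter>n. \<Union>m\<in>{n..}. F m)"
  proof (rule LIMSEQ_le_const)
    show "(\<lambda>n. prob (\<Union>m\<in>{n..}. F m)) \<longlonglongrightarrow> prob (\<Inter>n. \<Union>m\<in>{n..}. F m)"
      using F_ev by (intro finite_Lim_measure_decseq) (auto simp: decseq_def intro: order_trans)
    have "c \<le> prob (F n)" for n unfolding F_eq block by (rule L)
    moreover have "prob (F n) \<le> prob (\<Union>m\<in>{n..}. F m)" for n
      using F_ev by (intro finite_measure_mono) auto
    ultimately show "\<exists>N. \<forall>n\<ge>N. c \<le> prob (\<Union>m\<in>{n..}. F m)" by (meson order_trans)
  qed
  then have "prob (\<Inter>n. \<Union>m\<in>{n..}. F m) = 1"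
    using borel_0_1_law[OF ind] \<open>c > 0\<close> by auto
  then have io: "AE \<omega> in M. \<omega> \<in> (\<Inter>n. \<Union>m\<in>{n..}. F m)"
    by (rule AE_prob_1)
  have "AE \<omega> in M. \<forall>i\<in>{1..}. \<bar>X i \<omega>\<bar> \<le> B"
    by (subst AE_ball_countable) (auto intro: bounded)
  with io show ?thesis
  proof eventually_elim
    case (elim \<omega>)
    show ?case
    proof
      fix C :: real
      obtain n :: nat where n: "C \<le> n" using real_arch_simple by blast
      from elim(1) obtain k where k: "n \<le> k" "\<omega> \<in> F k" by auto
      have "{1..T (Suc k)} = {1..T k} \<union> {T k<..T (Suc k)}" using T_mono[of k "Suc k"] by auto
      then have "(\<Sum>i\<in>{1..T (Suc k)}. X i \<omega>)
          = (\<Sum>i\<in>{1..T k}. X i \<omega>) + (\<Sum>i\<in>{T k<..T (Suc k)}. X i \<omega>)"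
        by (simp only:) (rule sum.union_disjoint, auto)
      moreover have "(\<Sum>i\<in>{1..T k}. - B) \<le> (\<Sum>i\<in>{1..T k}. X i \<omega>)"
        using elim(2) by (intro sum_mono) (auto simp: abs_le_iff minus_le_iff)
      ultimately have "C < (\<Sum>i\<in>{1..T (Suc k)}. X i \<omega>)"
        using k n unfolding F_eq by (simp add: mult.commute)
      then show "\<exists>t. C < (\<Sum>i\<in>{1..t}. X i \<omega>)" ..
    qed
  qed
qed

text \<open>The common mean is the midpoint \<open>(a + b) / 2\<close>, which is nonnegative, and
  the values are almost surely bounded, so the general result applies.\<close>

lemma (in prob_space) uniform_partial_sums_unbounded_above:
  fixes X :: "nat \<Rightarrow> 'a \<Rightarrow> real"
  assumes indep: "indep_vars (\<lambda>i. borel) X {1..}"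
    and unif: "\<And>i. i \<ge> 1 \<Longrightarrow> distributed M lborel (X i)
           (\<lambda>y. indicator {a..b} y / measure lborel {a..b})"
    and "0 \<le> a + b"
  shows "AE \<omega> in M. \<forall>i\<ge>1. X i \<omega> \<in> {a..b}"
    and "AE \<omega> in M. \<forall>C. \<exists>t. C < (\<Sum>i\<in>{1..t}. X i \<omega>)"
proof -
  \<comment> \<open>On an interval of length 0 the quotient would vanish almost everywhere and could
    not be a probability density. This makes the variance positive.\<close>
  have "a < b" using uniform_distributed_bounds[OF unif[of 1]] by simp
  have rng: "AE \<omega> in M. X i \<omega> \<in> {a..b}" if "i \<ge> 1" for i
    by (subst distributed_AE2[OF unif[OF that]]) (auto simp: indicator_def)
  have "AE \<omega> in M. \<forall>i\<in>{1..}. X i \<omega> \<in> {a..b}"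
    by (subst AE_ball_countable) (use rng in auto)
  then show "AE \<omega> in M. \<forall>i\<ge>1. X i \<omega> \<in> {a..b}"
    by eventually_elim auto
  have distr: "distr M borel (X i) = density lborel (\<lambda>y. indicator {a..b} y / measure lborel {a..b})" if "i \<ge> 1" for i
    using distributed_distr_eq_density[OF unif[OF that]] distr_cong[of M M borel lborel "X i" "X i"] by simp
  show "AE \<omega> in M. \<forall>C. \<exists>t. C < (\<Sum>i\<in>{1..t}. X i \<omega>)"
  proof (rule AE_partial_sums_unbounded_above[OF indep _ _ _ _ distr])
    show "expectation (X i) = (a + b) / 2" if "i \<ge> 1" for i
      by (rule uniform_distributed_expectation[OF unif[OF that]])
    show "variance (X i) = (sqrt ((b - a)\<^sup>2 / 12))\<^sup>2" if "i \<ge> 1" for i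
      using uniform_distributed_variance[OF unif[OF that]] by simp
    show "AE \<omega> in M. \<bar>X i \<omega>\<bar> \<le> max \<bar>a\<bar> \<bar>b\<bar>" if "i \<ge> 1" for i
      using rng[OF that] by eventually_elim auto
  qed (use \<open>0 \<le> a + b\<close> \<open>a < b\<close> in auto)
qed

subsection \<open>Merging of clusters\<close>

text \<open>Serves to evaluate group sums in which agent 1 alone may deviate from a common
  value.\<close>

lemma sum_indicator_at:
  fixes f :: "nat \<Rightarrow> real"
  assumes "finite S" "i \<in> S" "\<And>j. j \<in> S - {i} \<Longrightarrow> f j = a"
  shows "sum f S = (real (card S) - 1) * a + f i"
proof -
  have "card S \<ge> 1" using assms(1,2) by (simp add: Suc_le_eq card_gt_0_iff) blast
  then show ?thesis using assms by (simp add: sum.remove of_nat_diff)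
qed

lemma neighbors_eqI:
  assumes "W \<subseteq> {1..n} \<union> {l}" "\<And>j. j \<in> W \<Longrightarrow> \<bar>y j - y i\<bar> \<le> \<epsilon>"
    and "\<And>j. j \<in> {1..n} \<union> {l} - W \<Longrightarrow> \<epsilon> < \<bar>y j - y i\<bar>"
  shows "neighbors n l \<epsilon> y i = W"
  using assms unfolding neighbors_def by force

text \<open>Positions are measured from the lower cluster: \<open>D\<close> is the gap to the upper cluster and \<open>\<eta>\<close>
  the offset of agent 1, which alone sees across the gap.\<close>
lemma bridge_estimates:
  fixes k p N D \<eta> \<epsilon> \<delta> :: real
  assumes "k \<ge> 1" "p \<ge> 1" "N = k + p" "2 * N * \<delta> \<le> \<epsilon>" "\<epsilon> < D" "D \<le> \<epsilon> + \<eta>" "\<eta> \<le> \<delta>" "0 < \<epsilon>"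
  defines "P \<equiv> (p * D + \<eta>) / (p + 1)" and "Q \<equiv> (p * D + \<eta>) / N"
  shows "Q \<le> P" "P \<le> \<epsilon> - \<epsilon> / N + \<delta>" "\<epsilon> / N \<le> Q" "2 * \<delta> \<le> \<epsilon> / N" "\<eta> \<le> P" "0 \<le> \<eta> / k" "\<eta> / k \<le> \<eta>" "0 < \<eta>"
proof -
  \<comment> \<open>Here \<open>k\<close> and \<open>p\<close> are the sizes of the lower and upper
    groups. \<open>P\<close> averages the upper cluster with agent 1, and \<open>Q\<close> averages
    both groups together, which is where agent 1 goes before noise.\<close>
  have N: "p + 1 \<le> N" "N > 0" using assms by auto
  show eta: "0 < \<eta>" using assms by auto
  have pD: "p * \<epsilon> \<le> p * D" "\<epsilon> \<le> p * \<epsilon>" using assms by auto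
  show "Q \<le> P" unfolding P_def Q_def using N pD eta assms by (intro divide_left_mono) auto
  show d: "2 * \<delta> \<le> \<epsilon> / N" using N assms by (simp add: field_simps)
  have "p * D \<le> p * (\<epsilon> + \<eta>)" using assms by (intro mult_left_mono) auto
  then have "p * D + \<eta> \<le> (\<epsilon> + \<eta>) * (p + 1) - \<epsilon>" by (simp add: algebra_simps)
  then have "P \<le> \<epsilon> + \<eta> - \<epsilon> / (p + 1)"
    unfolding P_def using divide_right_mono[of _ _ "p + 1"] assms by (fastforce simp: diff_divide_distrib)
  moreover have "\<epsilon> / N \<le> \<epsilon> / (p + 1)" using N assms by (intro divide_left_mono) auto
  ultimately show "P \<le> \<epsilon> - \<epsilon> / N + \<delta>" using assms by simp
  show "\<epsilon> / N \<le> Q" unfolding Q_def using N pD eta by (intro divide_right_mono) auto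
  have "\<epsilon> / N \<le> \<epsilon>" using divide_left_mono[of 1 N \<epsilon>] N assms by simp
  then have "\<eta> \<le> D" using d eta assms by linarith
  then have "p * \<eta> \<le> p * D" using assms by simp
  then show "\<eta> \<le> P" unfolding P_def using assms by (simp add: field_simps)
  show "0 \<le> \<eta> / k" "\<eta> / k \<le> \<eta>" using eta assms by (auto simp: field_simps)
qed

text \<open>One fixed outcome. The noise enters only through its bound and the unboundedness of its
  partial sums, so everything inside the locale is deterministic.\<close>

locale HK_path =
  fixes n l Nc :: nat and \<epsilon> \<delta> A :: real and V :: "nat \<Rightarrow> nat set" and xs \<xi> :: "nat \<Rightarrow> real"
    and x :: "nat \<Rightarrow> nat \<Rightarrow> real"
  assumes leader: "l \<notin> {1..n}"
    and eps_pos: "0 < \<epsilon>" and delta_pos: "0 < \<delta>" and delta_le: "\<delta> \<le> \<epsilon> / (2 * real n)"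
    and noise: "\<And>t. 1 \<le> t \<Longrightarrow> \<bar>\<xi> t\<bar> \<le> \<delta>"
    and unbounded: "\<And>C. \<exists>t. C < (\<Sum>i\<in>{1..t}. \<xi> i)"
    and init: "divisive_state n \<epsilon> Nc V xs (x 0)"
    and one: "1 \<in> V 1" and top: "xs Nc + \<epsilon> < A"
    and x_leader: "\<And>t. x t l = A"
    and x_Suc: "\<And>t i. i \<in> {1..n} \<Longrightarrow> x (Suc t) i =
      (\<Sum>j\<in>neighbors n l \<epsilon> (x t) i. x t j) / real (card (neighbors n l \<epsilon> (x t) i))
      + (if i = 1 then \<xi> (Suc t) else 0)"
begin

lemma Nc: "2 \<le> Nc" "Nc \<le> n"
  and cover: "(\<Union>g\<in>{1..Nc}. V g) = {1..n}"
  and disj: "disjoint_family_on V {1..Nc}"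
  and gap: "\<And>p q. p \<in> {1..Nc} \<Longrightarrow> q \<in> {1..Nc} \<Longrightarrow> q < p \<Longrightarrow> \<epsilon> < xs p - xs q"
  and x0: "\<And>g i. g \<in> {1..Nc} \<Longrightarrow> i \<in> V g \<Longrightarrow> x 0 i = xs g"
  and V_ne: "\<And>g. g \<in> {1..Nc} \<Longrightarrow> V g \<noteq> {}"
  using init unfolding divisive_state_def by auto

lemma n2: "2 \<le> n" using Nc by simp

lemma two_n_delta: "2 * real n * \<delta> \<le> \<epsilon>"
  using delta_le n2 by (simp add: field_simps)

lemma four_delta: "4 * \<delta> \<le> \<epsilon>"
proof -
  have "2 * 2 * \<delta> \<le> 2 * real n * \<delta>" using n2 delta_pos by (intro mult_right_mono) auto
  then show ?thesis using two_n_delta by linarith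
qed

lemma V_sub: "g \<in> {1..Nc} \<Longrightarrow> V g \<subseteq> {1..n}" using cover by blast

lemma V_unique: "g \<in> {1..Nc} \<Longrightarrow> h \<in> {1..Nc} \<Longrightarrow> i \<in> V g \<Longrightarrow> i \<in> V h \<Longrightarrow> g = h"
  using disj unfolding disjoint_family_on_def by blast

lemma one_not_in: "1 < h \<Longrightarrow> h \<le> Nc \<Longrightarrow> 1 \<notin> V h"
  using V_unique[of 1 h 1] one by auto

section \<open>Merged groups and the isolation of the clusters above them\<close>

definition merged :: "nat \<Rightarrow> nat set" where "merged g = (\<Union>h\<in>{1..g}. V h)"

text \<open>Above the last cluster the leader takes the role of the next cluster, so
  \<open>g = Nc\<close> fits the same invariant.\<close>

definition next_pos :: "nat \<Rightarrow> real" where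
  "next_pos g = (if g < Nc then xs (Suc g) else A)"

definition untouched :: "nat \<Rightarrow> nat \<Rightarrow> bool" where
  "untouched g t \<longleftrightarrow> (\<forall>h\<in>{g<..Nc}. \<forall>i\<in>V h. x t i = xs h)"

definition mean :: "nat \<Rightarrow> nat \<Rightarrow> real" where
  "mean g t = (\<Sum>j\<in>merged g. x t j) / real (card (merged g))"

text \<open>The invariant between merges. After a common averaging, agent 1 differs from the shared
  value \<open>m\<close> just by its latest noise term. The last conjunct restrains \<open>m\<close>
  alone, so agent 1 may already see the next cluster. If the group is \<open>{1}\<close>, then
  \<open>m\<close> is merely a reference value.\<close>

definition clustered :: "nat \<Rightarrow> nat \<Rightarrow> real \<Rightarrow> bool" where
  "clustered g t m \<longleftrightarrow> untouched g t \<and> (\<forall>i\<in>merged g - {1}. x t i = m) \<and>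
     \<bar>x t 1 - m\<bar> \<le> \<delta> \<and> m < next_pos g - \<epsilon>"

lemma merged_sub: "g \<le> Nc \<Longrightarrow> merged g \<subseteq> {1..n}"
  unfolding merged_def using V_sub by fastforce

lemma finite_merged: "g \<le> Nc \<Longrightarrow> finite (merged g)"
  using merged_sub finite_subset by blast

lemma one_merged: "1 \<le> g \<Longrightarrow> 1 \<in> merged g"
  unfolding merged_def using one by auto

lemma card_merged: "1 \<le> g \<Longrightarrow> g \<le> Nc \<Longrightarrow> 1 \<le> card (merged g)"
  using one_merged finite_merged by (metis One_nat_def Suc_leI card_gt_0_iff empty_iff)

lemma merged_Nc: "merged Nc = {1..n}" using cover by (simp add: merged_def)

lemma merged_Suc: "merged (Suc g) = merged g \<union> V (Suc g)"
  unfolding merged_def by (auto simp: atLeastAtMostSuc_conv)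

lemma merged_disjoint: "g < h \<Longrightarrow> h \<le> Nc \<Longrightarrow> merged g \<inter> V h = {}"
  unfolding merged_def using V_unique[of _ h] by fastforce

lemma below_top: "h \<in> {1..Nc} \<Longrightarrow> xs h + \<epsilon> < A"
  using gap[of Nc h] top eps_pos Nc by (cases "h = Nc") auto

lemma next_pos_le: "g < h \<Longrightarrow> h \<le> Nc \<Longrightarrow> next_pos g \<le> xs h"
  using gap[of h "Suc g"] eps_pos by (cases "h = Suc g") (auto simp: next_pos_def)

lemma next_pos_le_A: "next_pos g \<le> A"
  using below_top[of "Suc g"] eps_pos by (auto simp: next_pos_def)

lemma next_pos_Suc: "g < Nc \<Longrightarrow> next_pos g + \<epsilon> < next_pos (Suc g)"
  using gap[of "Suc (Suc g)" "Suc g"] below_top[of "Suc g"]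
  by (cases "Suc g < Nc") (auto simp: next_pos_def)

lemma outside_cases:
  assumes "j \<in> {1..n} \<union> {l} - merged g"
  obtains "j = l" | h where "g < h" "h \<le> Nc" "j \<in> V h"
proof (cases "j = l")
  case False
  then obtain h where "h \<in> {1..Nc}" "j \<in> V h" using assms cover by blast
  moreover have "g < h" using calculation assms by (auto simp: merged_def not_less[symmetric])
  ultimately show ?thesis using that by auto
qed (use that in auto)

lemma outside_ge:
  assumes "untouched g t" "j \<in> {1..n} \<union> {l} - merged g"
  shows "next_pos g \<le> x t j"
  using assms(2)
proof (cases rule: outside_cases)
  case 1 then show ?thesis by (simp add: x_leader next_pos_le_A)
next
  case (2 h) then show ?thesis using assms(1) next_pos_le[of g h] by (auto simp: untouched_def)
qed

text \<open>Each cluster above the merged group sees exactly itself: the group is too far below, the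
  other clusters are more than \<open>\<epsilon>\<close> away, and so is the leader. Its common
  value is reproduced without noise, since agent 1 belongs to the group.\<close>

lemma untouched_Suc:
  assumes "1 \<le> g" "untouched g t" and below: "\<And>j. j \<in> merged g \<Longrightarrow> x t j < next_pos g - \<epsilon>"
  shows "untouched g (Suc t)"
  unfolding untouched_def
proof (intro ballI)
  fix h i assume h: "h \<in> {g<..Nc}" and i: "i \<in> V h"
  have hN: "h \<in> {1..Nc}" using h assms(1) by auto
  have xV: "x t j = xs h" if "j \<in> V h" for j using assms(2) h that by (auto simp: untouched_def)
  have nb: "neighbors n l \<epsilon> (x t) i = V h"
  proof (rule neighbors_eqI)
    show "V h \<subseteq> {1..n} \<union> {l}" using V_sub[OF hN] by blast
    show "\<bar>x t j - x t i\<bar> \<le> \<epsilon>" if "j \<in> V h" for j using xV i that eps_pos by simp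
    fix j assume j: "j \<in> {1..n} \<union> {l} - V h"
    show "\<epsilon> < \<bar>x t j - x t i\<bar>"
    proof (cases "j \<in> merged g")
      case True
      then show ?thesis using below[OF True] next_pos_le[of g h] h xV[OF i] by auto
    next
      case False
      then have "j \<in> {1..n} \<union> {l} - merged g" using j by blast
      then show ?thesis
      proof (cases rule: outside_cases)
        case 1 then show ?thesis using below_top[OF hN] xV[OF i] by (simp add: x_leader)
      next
        case (2 h')
        then have "x t j = xs h'" using assms(2) by (auto simp: untouched_def)
        moreover have "h' \<noteq> h" using 2 j by auto
        ultimately show ?thesis using gap[of h h'] gap[of h' h] hN 2 xV[OF i] by (cases "h < h'") auto
      qed
    qed
  qed
  have "i \<in> {1..n}" using i V_sub[OF hN] by blast
  moreover have "i \<noteq> 1" using one_not_in[of h] h assms(1) i by auto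
  moreover have "card (V h) > 0"
    using V_ne[OF hN] V_sub[OF hN] finite_subset by (metis card_gt_0_iff finite_atLeastAtMost)
  ultimately show "x (Suc t) i = xs h"
    by (simp add: x_Suc nb xV)
qed

section \<open>The random walk of the group mean\<close>

lemma mean_less:
  assumes "1 \<le> g" "g \<le> Nc" "\<And>j. j \<in> merged g \<Longrightarrow> x t j < c"
  shows "mean g t < c"
proof -
  have "(\<Sum>j\<in>merged g. x t j) < real (card (merged g)) * c"
    using assms card_merged[of g] by (intro sum_bounded_above_strict) auto
  then show ?thesis using card_merged[OF assms(1,2)] by (simp add: mean_def field_simps)
qed

text \<open>Every member sees exactly the group, so all move to its mean and only agent 1 adds
  noise. Pairwise closeness is assumed instead of \<open>clustered\<close>, so that the step also
  applies to the spread-out configuration that arises during a merge.\<close>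

lemma merged_step:
  assumes g: "1 \<le> g" "g \<le> Nc" and un: "untouched g t"
    and close: "\<And>i j. i \<in> merged g \<Longrightarrow> j \<in> merged g \<Longrightarrow> \<bar>x t j - x t i\<bar> \<le> \<epsilon>"
    and below: "\<And>j. j \<in> merged g \<Longrightarrow> x t j < next_pos g - \<epsilon>"
  shows "clustered g (Suc t) (mean g t)"
    and "mean g (Suc t) = mean g t + \<xi> (Suc t) / real (card (merged g))"
proof -
  have new: "x (Suc t) i = mean g t + (if i = 1 then \<xi> (Suc t) else 0)" if i: "i \<in> merged g" for i
  proof -
    have "neighbors n l \<epsilon> (x t) i = merged g"
    proof (rule neighbors_eqI)
      show "\<epsilon> < \<bar>x t j - x t i\<bar>" if "j \<in> {1..n} \<union> {l} - merged g" for j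
        using outside_ge[OF un that] below[OF i] by auto
    qed (use close i merged_sub[OF g(2)] in auto)
    then show ?thesis using i merged_sub[OF g(2)] by (auto simp: x_Suc mean_def)
  qed
  show "clustered g (Suc t) (mean g t)"
    unfolding clustered_def
    using new one_merged[OF g(1)] noise[of "Suc t"] mean_less[OF g below]
      untouched_Suc[OF g(1) un below] by auto
  have "(\<Sum>j\<in>merged g. x (Suc t) j) = (real (card (merged g)) - 1) * mean g t + x (Suc t) 1"
    using new one_merged[OF g(1)] finite_merged[OF g(2)] by (intro sum_indicator_at) auto
  then show "mean g (Suc t) = mean g t + \<xi> (Suc t) / real (card (merged g))"
    using new[OF one_merged[OF g(1)]] card_merged[OF g]
    by (subst mean_def) (simp add: field_simps)
qed

text \<open>The first \<open>s\<close> terms contribute at most \<open>s * \<delta>\<close>, so the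
  sums restarted at any time are unbounded as well.\<close>

lemma noise_sum_unbounded: "\<exists>r. C < (\<Sum>i\<in>{s<..s+r}. \<xi> i)"
proof -
  \<comment> \<open>The absolute value keeps the threshold at least \<open>s * \<delta>\<close>,
    which excludes \<open>t \<le> s\<close>.\<close>
  obtain t where t: "\<bar>C\<bar> + real s * \<delta> < (\<Sum>i\<in>{1..t}. \<xi> i)" using unbounded by blast
  have bd: "(\<Sum>i\<in>{1..t'}. \<xi> i) \<le> real t' * \<delta>" for t'
    using sum_bounded_above[of "{1..t'}" \<xi> \<delta>] noise by (force simp: abs_le_iff)
  have "s < t"
  proof (rule ccontr)
    assume "\<not> s < t"
    then have "real t * \<delta> \<le> real s * \<delta>" using delta_pos by simp
    then show False using t bd[of t] by linarith
  qed
  then have "{1..t} = {1..s} \<union> {s<..s+(t-s)}" by auto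
  then have "(\<Sum>i\<in>{1..t}. \<xi> i) = (\<Sum>i\<in>{1..s}. \<xi> i) + (\<Sum>i\<in>{s<..s+(t-s)}. \<xi> i)"
    by (simp only:) (rule sum.union_disjoint, auto)
  then have "C < (\<Sum>i\<in>{s<..s+(t-s)}. \<xi> i)" using t bd[of s] by linarith
  then show ?thesis ..
qed

lemma noise_sum_Suc: "(\<Sum>i\<in>{s<..Suc (s + r)}. \<xi> i) = (\<Sum>i\<in>{s<..s + r}. \<xi> i) + \<xi> (Suc (s + r))"
proof -
  have "{s<..Suc (s + r)} = insert (Suc (s + r)) {s<..s + r}" by auto
  then show ?thesis by simp
qed

text \<open>If agent 1 never came into sight of the next position, the group would stay isolated
  forever and its mean would follow the noise sums divided by the group size. The mean would stay
  below \<open>next_pos g - \<epsilon>\<close>, although those sums are unbounded.\<close>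

lemma reaches_next:
  assumes g: "1 \<le> g" "g \<le> Nc" and "clustered g s m0"
  shows "\<exists>t m. clustered g t m \<and> next_pos g - \<epsilon> \<le> x t 1"
proof (rule ccontr)
  assume neg: "\<not> ?thesis"
  have below: "x t j < next_pos g - \<epsilon>" if "clustered g t m" "j \<in> merged g" for t m j
  proof (cases "j = 1")
    case True
    then show ?thesis using neg that(1) not_le by blast
  qed (use that in \<open>auto simp: clustered_def\<close>)
  let ?k = "real (card (merged g))"
  have "\<exists>m. clustered g (s + r) m \<and> mean g (s + r) = mean g s + (\<Sum>i\<in>{s<..s+r}. \<xi> i) / ?k" for r
  proof (induction r)
    case 0 then show ?case using assms(3) by auto
  next
    case (Suc r)
    then obtain m where m: "clustered g (s + r) m"
      and mean: "mean g (s + r) = mean g s + (\<Sum>i\<in>{s<..s+r}. \<xi> i) / ?k" by blast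
    have un: "untouched g (s + r)" using m by (simp add: clustered_def)
    have close: "\<bar>x (s + r) j - x (s + r) i\<bar> \<le> \<epsilon>" if "i \<in> merged g" "j \<in> merged g" for i j
      using m that four_delta delta_pos by (cases "i = 1"; cases "j = 1") (auto simp: clustered_def abs_minus_commute)
    from merged_step[OF g un close below[OF m]] mean show ?case
      by (auto simp: noise_sum_Suc add_divide_distrib)
  qed
  then have "?k * (next_pos g - \<epsilon> - mean g s) > (\<Sum>i\<in>{s<..s+r}. \<xi> i)" for r
  proof -
    obtain m where "clustered g (s + r) m"
      and mean: "mean g (s + r) = mean g s + (\<Sum>i\<in>{s<..s+r}. \<xi> i) / ?k"
      using \<open>\<And>r. \<exists>m. _ r m\<close> by blast
    then have "(\<Sum>i\<in>{s<..s+r}. \<xi> i) / ?k < next_pos g - \<epsilon> - mean g s"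
      using mean_less[OF g, of "s + r" "next_pos g - \<epsilon>"] below by fastforce
    then show ?thesis using card_merged[OF g] by (simp add: divide_less_eq mult.commute)
  qed
  then show False using noise_sum_unbounded by (meson less_asym)
qed

text \<open>In the first step agent 1 alone links the two groups: the other lower agents move to
  \<open>a + \<eta> / k\<close>, the upper cluster to \<open>a + P\<close>, and agent 1 to
  \<open>a + Q\<close> plus noise. These positions are pairwise within \<open>\<epsilon>\<close> and
  still out of sight of whatever lies above, so the second step averages the union.\<close>

lemma absorbs_next:
  assumes g: "1 \<le> g" "g < Nc" and cl: "clustered g t a" and sees: "next_pos g - \<epsilon> \<le> x t 1"
  shows "\<exists>m. clustered (Suc g) (Suc (Suc t)) m"
proof -
  define b where "b = xs (Suc g)"
  have b: "next_pos g = b" using g by (simp add: next_pos_def b_def)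
  define k p where "k = real (card (merged g))" and "p = real (card (V (Suc g)))"
  define y where "y = x t 1"
  define D \<eta> where "D = b - a" and "\<eta> = y - a"
  define P Q where "P = (p * D + \<eta>) / (p + 1)" and "Q = (p * D + \<eta>) / (k + p)"
  have gN: "Suc g \<in> {1..Nc}" using g by auto
  have finV: "finite (V (Suc g))" using V_sub[OF gN] finite_subset by blast
  have k1: "1 \<le> k" using card_merged[of g] g by (simp add: k_def)
  have p1: "1 \<le> p" using V_ne[OF gN] finV by (simp add: p_def Suc_le_eq card_gt_0_iff)
  have dis: "merged g \<inter> V (Suc g) = {}" using merged_disjoint g by simp
  have card: "real (card (merged (Suc g))) = k + p"
    using dis finV finite_merged[of g] g by (simp add: merged_Suc card_Un_disjoint k_def p_def)
  have "card (merged (Suc g)) \<le> n"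
    using card_mono[OF _ merged_sub[of "Suc g"]] g by simp
  then have "2 * (k + p) * \<delta> \<le> 2 * real n * \<delta>" using card delta_pos by (intro mult_right_mono) auto
  then have "2 * (k + p) * \<delta> \<le> \<epsilon>" using two_n_delta by simp
  moreover have "\<epsilon> < D" "D \<le> \<epsilon> + \<eta>" "\<eta> \<le> \<delta>"
    using cl sees by (auto simp: clustered_def b D_def \<eta>_def y_def)
  ultimately have est: "Q \<le> P" "P \<le> \<epsilon> - \<epsilon> / (k + p) + \<delta>" "\<epsilon> / (k + p) \<le> Q" "2 * \<delta> \<le> \<epsilon> / (k + p)"
      "\<eta> \<le> P" "0 \<le> \<eta> / k" "\<eta> / k \<le> \<eta>" "0 < \<eta>" and D: "\<epsilon> < D" "D \<le> \<epsilon> + \<eta>" "\<eta> \<le> \<delta>"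
    using bridge_estimates[OF k1 p1 refl _ _ _ _ eps_pos] unfolding P_def Q_def by auto
  have y: "y < b" using D four_delta delta_pos unfolding D_def \<eta>_def by linarith
  have un: "untouched g t" using cl by (simp add: clustered_def)
  then have un': "untouched (Suc g) t" by (auto simp: untouched_def)
  have xa: "x t j = a" if "j \<in> merged g - {1}" for j using cl that by (auto simp: clustered_def)
  have xb: "x t j = b" if "j \<in> V (Suc g)" for j
    using un that g by (auto simp: untouched_def b_def)
  have cases: thesis if "j \<in> {1..n} \<union> {l}" "j = 1 \<Longrightarrow> thesis" "j \<in> merged g - {1} \<Longrightarrow> thesis"
      "j \<in> V (Suc g) \<Longrightarrow> thesis" "j \<in> {1..n} \<union> {l} - merged (Suc g) \<Longrightarrow> thesis" for j thesis
    using that by (auto simp: merged_Suc)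
  have far: "b + \<epsilon> < x t j" if "j \<in> {1..n} \<union> {l} - merged (Suc g)" for j
    using outside_ge[OF un' that] next_pos_Suc[OF g(2)] b by simp
  have sub: "merged (Suc g) \<subseteq> {1..n}" using merged_sub g by simp
  have sumg: "(\<Sum>j\<in>merged g. x t j) = (k - 1) * a + y"
    unfolding k_def y_def using xa one_merged g finite_merged by (intro sum_indicator_at) auto
  have sumV: "(\<Sum>j\<in>V (Suc g). x t j) = p * b" using xb by (simp add: p_def)
  have new_low: "x (Suc t) i = a + \<eta> / k" if i: "i \<in> merged g - {1}" for i
  proof -
    have "neighbors n l \<epsilon> (x t) i = merged g"
    proof (rule neighbors_eqI)
      show "\<bar>x t j - x t i\<bar> \<le> \<epsilon>" if "j \<in> merged g" for j
        using that xa[OF i] xa[of j] cl eps_pos four_delta delta_pos by (cases "j = 1") (auto simp: clustered_def)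
      show "\<epsilon> < \<bar>x t j - x t i\<bar>" if "j \<in> {1..n} \<union> {l} - merged g" for j
        using outside_ge[OF un that] xa[OF i] D b by (auto simp: D_def)
    qed (use sub merged_Suc in auto)
    then show ?thesis using i sub sumg k1 by (auto simp: x_Suc merged_Suc k_def[symmetric] \<eta>_def field_simps)
  qed
  have new_up: "x (Suc t) i = a + P" if i: "i \<in> V (Suc g)" for i
  proof -
    have "neighbors n l \<epsilon> (x t) i = insert 1 (V (Suc g))"
    proof (rule neighbors_eqI)
      show "insert 1 (V (Suc g)) \<subseteq> {1..n} \<union> {l}" using sub merged_Suc one_merged[of g] g by auto
      show "\<bar>x t j - x t i\<bar> \<le> \<epsilon>" if "j \<in> insert 1 (V (Suc g))" for j
        using that xb xb[OF i] eps_pos sees y b by (auto simp: y_def)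
      fix j assume j: "j \<in> {1..n} \<union> {l} - insert 1 (V (Suc g))"
      then have "j \<in> {1..n} \<union> {l}" by blast
      then show "\<epsilon> < \<bar>x t j - x t i\<bar>"
        by (rule cases) (use j xb[OF i] xa[of j] far[of j] D D_def in auto)
    qed
    moreover have "1 \<notin> V (Suc g)" "i \<noteq> 1" using one_not_in[of "Suc g"] g i by auto
    moreover have "i \<in> {1..n}" using i sub merged_Suc by auto
    ultimately have "x (Suc t) i = (y + p * b) / (1 + p)"
      using sumV finV by (simp add: x_Suc y_def p_def)
    then show ?thesis using p1 by (simp add: P_def D_def \<eta>_def field_simps)
  qed
  have new_one: "x (Suc t) 1 = a + Q + \<xi> (Suc t)"
  proof -
    have "neighbors n l \<epsilon> (x t) 1 = merged (Suc g)"
    proof (rule neighbors_eqI)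
      show "\<bar>x t j - x t 1\<bar> \<le> \<epsilon>" if "j \<in> merged (Suc g)" for j
      proof -
        have "j \<in> {1..n} \<union> {l}" using that sub by blast
        then show ?thesis
          by (rule cases) (use that xa[of j] xb[of j] sees b y eps_pos cl four_delta delta_pos in
              \<open>auto simp: y_def clustered_def\<close>)
      qed
      show "\<epsilon> < \<bar>x t j - x t 1\<bar>" if "j \<in> {1..n} \<union> {l} - merged (Suc g)" for j
        using far[OF that] y by (auto simp: y_def)
    qed (use sub in auto)
    moreover have "(\<Sum>j\<in>merged (Suc g). x t j) = (k - 1) * a + y + p * b"
      using sumg sumV dis finV finite_merged[of g] g by (simp add: merged_Suc sum.union_disjoint)
    ultimately have "x (Suc t) 1 = ((k - 1) * a + y + p * b) / (k + p) + \<xi> (Suc t)"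
      using n2 card by (simp add: x_Suc)
    then show ?thesis using k1 p1 by (simp add: Q_def D_def \<eta>_def field_simps)
  qed
  have xi: "\<bar>\<xi> (Suc t)\<bar> \<le> \<delta>" using noise by simp
  have new_pos: "x (Suc t) j \<in> {a + \<eta> / k, a + P, a + Q + \<xi> (Suc t)}" if "j \<in> merged (Suc g)" for j
    using that new_low[of j] new_up[of j] new_one by (cases "j = 1") (auto simp: merged_Suc)
  have "clustered (Suc g) (Suc (Suc t)) (mean (Suc g) (Suc t))"
  proof (rule merged_step(1))
    show "untouched (Suc g) (Suc t)"
    proof (rule untouched_Suc[OF _ un'])
      fix j assume j: "j \<in> merged (Suc g)"
      then have "j \<in> {1..n} \<union> {l}" using sub by blast
      then have "x t j \<le> b"
        by (rule cases) (use j xa[of j] xb[of j] y D eps_pos in \<open>auto simp: y_def D_def\<close>)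
      then show "x t j < next_pos (Suc g) - \<epsilon>" using next_pos_Suc[OF g(2)] b by simp
    qed simp
    show "\<bar>x (Suc t) j - x (Suc t) i\<bar> \<le> \<epsilon>" if "i \<in> merged (Suc g)" "j \<in> merged (Suc g)" for i j
    proof -
      \<comment> \<open>Since \<open>2 * \<delta> \<le> \<epsilon> / (k + p)\<close>, the bound on
        \<open>P\<close> gives \<open>Q \<le> P \<le> \<epsilon> - \<delta>\<close>, which leaves
        room for one noise term.\<close>
      have pairs: "\<bar>P - \<eta> / k\<bar> \<le> \<epsilon>" "\<bar>Q + \<xi> (Suc t) - \<eta> / k\<bar> \<le> \<epsilon>" "\<bar>P - (Q + \<xi> (Suc t))\<bar> \<le> \<epsilon>"
        using est D xi four_delta delta_pos eps_pos by (auto simp: abs_le_iff)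
      then show ?thesis using new_pos[OF that(1)] new_pos[OF that(2)] eps_pos
        by (auto simp: abs_le_iff algebra_simps)
    qed
    show "x (Suc t) j < next_pos (Suc g) - \<epsilon>" if "j \<in> merged (Suc g)" for j
    proof -
      \<comment> \<open>All displacements from \<open>a\<close> are at most
        \<open>\<epsilon>\<close>, which is less than \<open>D\<close>, so nobody passes the old
        position of the upper cluster.\<close>
      have "x (Suc t) j \<le> b" 
        using new_pos[OF that] est D xi four_delta delta_pos unfolding D_def by (auto simp: abs_le_iff)
      then show ?thesis using next_pos_Suc[OF g(2)] b by simp
    qed
  qed (use g in auto)
  then show ?thesis ..
qed

text \<open>Induction on the number of merged clusters: a waiting phase by
  \<open>reaches_next\<close>, then two steps by \<open>absorbs_next\<close>.\<close>

lemma eventually_all_merged: "\<exists>t m. clustered Nc t m"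
proof -
  have "g \<le> Nc \<Longrightarrow> \<exists>t m. clustered g t m" if "1 \<le> g" for g
    using that
  proof (induction g rule: nat_induct_at_least)
    case base
    have "merged 1 = V 1" by (simp add: merged_def)
    moreover have "x 0 i = xs 1" if "i \<in> V 1" for i using x0[of 1 i] that Nc by simp
    moreover have "untouched 1 0" using x0 by (auto simp: untouched_def)
    moreover have "xs 1 < next_pos 1 - \<epsilon>"
      using Nc gap[of 2 1] by (simp add: next_pos_def numeral_2_eq_2)
    ultimately have "clustered 1 0 (xs 1)"
      using one delta_pos by (simp add: clustered_def)
    then show ?case by blast
  next
    case (Suc g)
    then obtain s m where "clustered g s m" by auto
    then obtain t m where "clustered g t m" "next_pos g - \<epsilon> \<le> x t 1"
      using reaches_next[of g s m] Suc by (meson Suc_leD)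
    then show ?case using absorbs_next[of g t m] Suc.hyps Suc.prems by (meson Suc_le_lessD)
  qed
  then show ?thesis using Nc by simp
qed

subsection \<open>Capture by the leader\<close>

text \<open>Signed distances below the leader: \<open>u\<close> for the agents other than 1,
  \<open>v\<close> for agent 1; both may become negative. The last conjunct makes all ordinary
  agents see one another.\<close>

definition near :: "nat \<Rightarrow> real \<Rightarrow> real \<Rightarrow> bool" where
  "near t u v \<longleftrightarrow> (\<forall>i\<in>{2..n}. x t i = A - u) \<and> x t 1 = A - v \<and> \<bar>u - v\<bar> \<le> \<epsilon>"

text \<open>An agent at distance \<open>w\<close> that sees the leader averages over
  \<open>n + 1\<close> agents, one of them at distance 0, so the mean distance is scaled by
  \<open>n / (n + 1)\<close>.\<close>

definition pull :: "real \<Rightarrow> real" where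
  "pull w = (if \<bar>w\<bar> \<le> \<epsilon> then real n / (real n + 1) else 1)"

definition wmean :: "real \<Rightarrow> real \<Rightarrow> real" where
  "wmean u v = ((real n - 1) * u + v) / real n"

lemma near_step:
  assumes "near t u v"
  shows "\<forall>i\<in>{2..n}. x (Suc t) i = A - pull u * wmean u v"
    and "x (Suc t) 1 = A - (pull v * wmean u v - \<xi> (Suc t))"
proof -
  have sum: "(\<Sum>j\<in>{1..n}. x t j) = real n * (A - wmean u v)"
  proof -
    have "(\<Sum>j\<in>{1..n}. x t j) = (real (card {1..n}) - 1) * (A - u) + x t 1"
      using assms n2 by (intro sum_indicator_at) (auto simp: near_def)
    moreover have "x t 1 = A - v" using assms by (simp add: near_def)
    moreover have "real n * wmean u v = (real n - 1) * u + v" using n2 by (simp add: wmean_def)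
    ultimately show ?thesis by (simp add: algebra_simps)
  qed
  have new: "x (Suc t) i = A - pull w * wmean u v + (if i = 1 then \<xi> (Suc t) else 0)"
    if i: "i \<in> {1..n}" and w: "x t i = A - w" for i w
  proof -
    have pos: "x t j \<in> {A - u, A - v}" if "j \<in> {1..n}" for j
      using assms that by (cases "j = 1") (auto simp: near_def)
    have close: "\<bar>x t j - x t i\<bar> \<le> \<epsilon>" if "j \<in> {1..n}" for j
      using pos[OF that] pos[OF i] assms eps_pos by (auto simp: near_def abs_minus_commute)
    show ?thesis
    proof (cases "\<bar>w\<bar> \<le> \<epsilon>")
      case True
      have "neighbors n l \<epsilon> (x t) i = insert l {1..n}"
        by (rule neighbors_eqI) (use close True w x_leader in auto)
      then show ?thesis using i leader sum True n2
        by (simp add: x_Suc x_leader pull_def field_simps)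
    next
      case False
      have "neighbors n l \<epsilon> (x t) i = {1..n}"
        by (rule neighbors_eqI) (use close False w x_leader in auto)
      then show ?thesis using i sum False n2 by (simp add: x_Suc pull_def)
    qed
  qed
  show "\<forall>i\<in>{2..n}. x (Suc t) i = A - pull u * wmean u v"
    using new assms by (auto simp: near_def)
  show "x (Suc t) 1 = A - (pull v * wmean u v - \<xi> (Suc t))"
    using new[of 1 v] assms n2 by (auto simp: near_def)
qed

lemma pull_bounds: "0 < pull w" "pull w \<le> 1"
  using n2 by (auto simp: pull_def)

lemma wmean_shift: "wmean a (b - c) = wmean a b - c / real n"
  by (simp add: wmean_def diff_divide_distrib add_divide_distrib)

lemma wmean_mono: "a \<le> a' \<Longrightarrow> b \<le> b' \<Longrightarrow> wmean a b \<le> wmean a' b'"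
  unfolding wmean_def using n2 by (intro divide_right_mono add_mono mult_left_mono) auto

lemma wmean_same: "wmean a a = a"
  using n2 by (simp add: wmean_def field_simps)

lemma abs_wmean: "\<bar>a\<bar> \<le> c \<Longrightarrow> \<bar>b\<bar> \<le> c \<Longrightarrow> \<bar>wmean a b\<bar> \<le> c"
  using wmean_mono[of a c b c] wmean_mono[of "- c" a "- c" b] wmean_same by (auto simp: abs_le_iff)

text \<open>Otherwise the mean distance \<open>wmean u v\<close> would stay nonnegative, so that
  scaling by \<open>pull\<close> could only decrease it. It would then be dominated by
  \<open>w0\<close> minus the noise sums over \<open>n\<close>, which become arbitrarily
  large.\<close>

lemma eventually_captured: "\<exists>t u v. near t u v \<and> \<bar>u\<bar> \<le> \<epsilon> \<and> \<bar>v\<bar> \<le> \<epsilon>"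
proof (rule ccontr)
  assume neg: "\<not> ?thesis"
  obtain s m where m: "clustered Nc s m" using eventually_all_merged by blast
  define w0 where "w0 = wmean (A - m) (A - x s 1)"
  define inv where "inv t u v \<longleftrightarrow> near t u v \<and> 0 \<le> u \<and> - \<epsilon> \<le> v" for t u v
  \<comment> \<open>Without capture, one of \<open>u\<close> and \<open>v\<close> exceeds
    \<open>\<epsilon>\<close>; as they differ by at most \<open>\<epsilon>\<close>, this forces
    \<open>0 \<le> v\<close>.\<close>
  have pos: "0 \<le> wmean u v" if "inv t u v" for t u v
  proof -
    have "\<not> (\<bar>u\<bar> \<le> \<epsilon> \<and> \<bar>v\<bar> \<le> \<epsilon>)" using neg that unfolding inv_def by blast
    then have "\<epsilon> < u \<or> \<epsilon> < v" using that by (auto simp: inv_def)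
    then have "0 \<le> v" using that by (auto simp: inv_def near_def)
    then show ?thesis using that wmean_mono[of 0 u 0 v] wmean_same[of 0] by (simp add: inv_def)
  qed
  have "\<exists>u v. inv (s + r) u v \<and> wmean u v \<le> w0 - (\<Sum>i\<in>{s<..s+r}. \<xi> i) / real n" for r
  proof (induction r)
    case 0
    have "near s (A - m) (A - x s 1)"
      using m four_delta delta_pos merged_Nc by (auto simp: near_def clustered_def)
    moreover have "A - m \<ge> 0" "- \<epsilon> \<le> A - x s 1"
      using m four_delta eps_pos delta_pos by (auto simp: clustered_def next_pos_def)
    ultimately show ?case
      by (intro exI[of _ "A - m"] exI[of _ "A - x s 1"]) (simp add: w0_def inv_def)
  next
    case (Suc r)
    then obtain u v where I: "inv (s + r) u v"
      and w: "wmean u v \<le> w0 - (\<Sum>i\<in>{s<..s+r}. \<xi> i) / real n" by blast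
    let ?w = "wmean u v" and ?x = "\<xi> (Suc (s + r))"
    define u' v' where "u' = pull u * ?w" and "v' = pull v * ?w"
    have w0: "0 \<le> ?w" using pos[OF I] .
    have x: "\<bar>?x\<bar> \<le> \<delta>" using noise by simp
    have u': "0 \<le> u'" "u' \<le> ?w" and v': "0 \<le> v'" "v' \<le> ?w"
      using w0 pull_bounds[of u] pull_bounds[of v] by (auto simp: u'_def v'_def mult_left_le_one_le)
    have nr: "near (s + r) u v" using I by (simp add: inv_def)
    \<comment> \<open>The factors differ only if exactly one of the two positions sees the leader.
      Then the other is within \<open>2 * \<epsilon>\<close>, and \<open>n \<ge> 2\<close> gives the
      factor \<open>1 / 3\<close>. Adding the noise, at most \<open>\<epsilon> / 4\<close>, keeps
      the agents within \<open>\<epsilon>\<close> of each other.\<close>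
    have "\<bar>u' - v'\<bar> \<le> 2 * \<epsilon> / 3"
    proof (cases "\<bar>u\<bar> \<le> \<epsilon> \<longleftrightarrow> \<bar>v\<bar> \<le> \<epsilon>")
      case True then show ?thesis using eps_pos by (auto simp: u'_def v'_def pull_def)
    next
      case False
      then have "\<bar>u\<bar> \<le> 2 * \<epsilon>" "\<bar>v\<bar> \<le> 2 * \<epsilon>" using nr by (auto simp: near_def)
      then have "?w \<le> 2 * \<epsilon>" using abs_wmean[of u "2 * \<epsilon>" v] by simp
      then have "?w / (real n + 1) \<le> 2 * \<epsilon> / 3" using n2 w0 eps_pos by (intro frac_le) auto
      moreover have "\<bar>u' - v'\<bar> = ?w / (real n + 1)"
      proof -
        have "1 - real n / (real n + 1) = 1 / (real n + 1)" by (simp add: field_simps)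
        moreover have "pull u - pull v = real n / (real n + 1) - 1
            \<or> pull u - pull v = 1 - real n / (real n + 1)"
          using False by (auto simp: pull_def)
        moreover have "0 \<le> 1 / (real n + 1)" by simp
        ultimately have "\<bar>pull u - pull v\<bar> = 1 / (real n + 1)" by linarith
        moreover have "u' - v' = (pull u - pull v) * ?w" by (simp add: u'_def v'_def left_diff_distrib)
        ultimately show ?thesis using w0 by (simp add: abs_mult)
      qed
      ultimately show ?thesis by simp
    qed
    then have "\<bar>u' - (v' - ?x)\<bar> \<le> \<epsilon>" using x four_delta eps_pos by linarith
    then have "near (Suc (s + r)) u' (v' - ?x)"
      using near_step[OF nr] by (simp add: near_def u'_def v'_def)
    then have "inv (Suc (s + r)) u' (v' - ?x)"
      using u' v' x four_delta delta_pos by (auto simp: inv_def)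
    moreover have "wmean u' (v' - ?x) \<le> ?w - ?x / real n"
      using wmean_mono[OF u'(2) v'(2)] by (simp add: wmean_shift wmean_same)
    ultimately show ?case using w
      by (intro exI[of _ u'] exI[of _ "v' - ?x"]) (simp add: noise_sum_Suc add_divide_distrib)
  qed
  then have "0 \<le> w0 - (\<Sum>i\<in>{s<..s+r}. \<xi> i) / real n" for r
    using pos by (meson order_trans)
  moreover obtain r where "real n * w0 < (\<Sum>i\<in>{s<..s+r}. \<xi> i)" using noise_sum_unbounded by blast
  ultimately show False using n2 by (auto simp: field_simps not_less[symmetric])
qed

text \<open>After capture everybody sees the leader. The distance \<open>w\<close> of the other
  agents obeys \<open>w' = q * (w - \<xi> / n)\<close>, whose size is attracted to at most
  \<open>\<delta>\<close>; agent 1 adds one more noise term.\<close>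

lemma eventually_max_dist_le:
  assumes "0 < e"
  shows "\<forall>\<^sub>F t in sequentially. max_dist n A (x t) \<le> 2 * \<delta> + e"
proof -
  obtain T u v where T: "near T u v" "\<bar>u\<bar> \<le> \<epsilon>" "\<bar>v\<bar> \<le> \<epsilon>" using eventually_captured by blast
  define q where "q = real n / (real n + 1)"
  have q: "0 < q" "q < 1" using n2 by (auto simp: q_def)
  \<comment> \<open>Makes capture absorbing: the contraction frees
    \<open>\<epsilon> / (n + 1)\<close>, which is at least \<open>\<epsilon> / (2 * n)\<close> and
    hence covers the noise.\<close>
  have q_eps: "q * \<epsilon> + \<delta> \<le> \<epsilon>"
  proof -
    have "\<epsilon> / (2 * real n) \<le> \<epsilon> / (real n + 1)" using n2 eps_pos by (intro frac_le) auto
    then have "\<delta> \<le> 1 / (real n + 1) * \<epsilon>" using delta_le by simp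
    moreover have "q * \<epsilon> + 1 / (real n + 1) * \<epsilon> = \<epsilon>"
      using n2 by (simp add: q_def add_divide_distrib[symmetric] distrib_right[symmetric]
          del: times_divide_eq_left)
    ultimately show ?thesis by simp
  qed
  have step: "near (Suc t) (q * wmean u v) (q * wmean u v - \<xi> (Suc t)) \<and>
      \<bar>q * wmean u v\<bar> \<le> \<epsilon> \<and> \<bar>q * wmean u v - \<xi> (Suc t)\<bar> \<le> \<epsilon>"
    if "near t u v" "\<bar>u\<bar> \<le> \<epsilon>" "\<bar>v\<bar> \<le> \<epsilon>" for t u v
  proof -
    have "pull u = q" "pull v = q" using that by (auto simp: pull_def q_def)
    have "q * \<bar>wmean u v\<bar> \<le> q * \<epsilon>" using abs_wmean[OF that(2,3)] q by simp
    then have "\<bar>q * wmean u v\<bar> \<le> q * \<epsilon>" using q by (simp add: abs_mult)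
    moreover have "\<bar>\<xi> (Suc t)\<bar> \<le> \<delta>" using noise by simp
    ultimately show ?thesis
      using near_step[OF that(1)] \<open>pull u = q\<close> \<open>pull v = q\<close> q_eps four_delta delta_pos
      by (auto simp: near_def)
  qed
  \<comment> \<open>The count starts one step after capture, because only then do agent 1 and the
    others differ exactly by the current noise term.\<close>
  have "\<exists>w. near (T + Suc r) w (w - \<xi> (T + Suc r)) \<and> \<bar>w\<bar> \<le> \<epsilon> \<and> \<bar>w - \<xi> (T + Suc r)\<bar> \<le> \<epsilon> \<and>
      \<bar>w\<bar> - \<delta> \<le> q ^ r * \<epsilon>" for r
  proof (induction r)
    case 0
    show ?case using step[OF T] delta_pos by (intro exI[of _ "q * wmean u v"]) auto
  next
    case (Suc r)
    then obtain w where w: "near (T + Suc r) w (w - \<xi> (T + Suc r))" "\<bar>w\<bar> \<le> \<epsilon>"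
      "\<bar>w - \<xi> (T + Suc r)\<bar> \<le> \<epsilon>" "\<bar>w\<bar> - \<delta> \<le> q ^ r * \<epsilon>" by blast
    define w' where "w' = q * wmean w (w - \<xi> (T + Suc r))"
    have "w' = q * (w - \<xi> (T + Suc r) / real n)" by (simp add: w'_def wmean_shift wmean_same)
    moreover have "\<bar>w - \<xi> (T + Suc r) / real n\<bar> \<le> \<bar>w\<bar> + \<delta> / real n"
    proof -
      have "\<bar>\<xi> (T + Suc r) / real n\<bar> \<le> \<delta> / real n"
        using noise[of "T + Suc r"] n2 by (simp add: divide_right_mono)
      then show ?thesis by linarith
    qed
    ultimately have "\<bar>w'\<bar> \<le> q * (\<bar>w\<bar> + \<delta> / real n)" using q by (simp add: abs_mult)
    \<comment> \<open>As \<open>q / n = 1 - q\<close>, the map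
      \<open>s \<mapsto> q * (s + \<delta> / n)\<close> has fixed point \<open>\<delta>\<close>, so
      the excess over \<open>\<delta>\<close> is multiplied by \<open>q\<close>.\<close>
    also have "\<dots> = q * (\<bar>w\<bar> - \<delta>) + \<delta>"
    proof -
      have "(real n + 1) * q = real n" by (simp add: q_def)
      then have "q = real n * (1 - q)" by (simp add: algebra_simps)
      then have "q / real n = 1 - q" using n2 by (metis nonzero_mult_div_cancel_left not_numeral_le_zero of_nat_eq_0_iff)
      then have "q * (\<delta> / real n) = (1 - q) * \<delta>" by (metis times_divide_eq_left times_divide_eq_right)
      then show ?thesis by (simp add: algebra_simps)
    qed
    also have "q * (\<bar>w\<bar> - \<delta>) \<le> q * (q ^ r * \<epsilon>)" using w(4) q by (intro mult_left_mono) auto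
    finally have "\<bar>w'\<bar> - \<delta> \<le> q ^ Suc r * \<epsilon>" by simp
    then show ?case using step[OF w(1-3)] by (intro exI[of _ w']) (simp add: w'_def)
  qed
  then have bound: "max_dist n A (x (T + Suc r)) \<le> 2 * \<delta> + q ^ r * \<epsilon>" for r
  proof -
    obtain w where w: "near (T + Suc r) w (w - \<xi> (T + Suc r))" "\<bar>w\<bar> - \<delta> \<le> q ^ r * \<epsilon>"
      using \<open>\<And>r. \<exists>w. _ r w\<close> by blast
    have "\<bar>x (T + Suc r) i - A\<bar> \<le> 2 * \<delta> + q ^ r * \<epsilon>" if "i \<in> {1..n}" for i
    proof (cases "i = 1")
      case True
      then have "x (T + Suc r) i - A = - (w - \<xi> (T + Suc r))" using w(1) unfolding near_def by simp
      then show ?thesis using w(2) noise[of "T + Suc r"] by (auto simp: abs_le_iff)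
    next
      case False
      then have "x (T + Suc r) i - A = - w" using w(1) that unfolding near_def by simp
      then show ?thesis using w(2) delta_pos by simp
    qed
    then show ?thesis unfolding max_dist_def using n2 by (subst Max_le_iff) auto
  qed
  have "(\<lambda>r. q ^ r * \<epsilon>) \<longlonglongrightarrow> 0" using q by (intro tendsto_mult_left_zero LIMSEQ_realpow_zero) auto
  then have "\<forall>\<^sub>F r in sequentially. q ^ r * \<epsilon> < e" using assms by (rule order_tendstoD(2))
  then obtain R where R: "\<And>r. R \<le> r \<Longrightarrow> q ^ r * \<epsilon> < e" by (auto simp: eventually_sequentially)
  show ?thesis
  proof (rule eventually_sequentiallyI)
    fix t assume "T + Suc R \<le> t"
    then obtain r where "t = T + Suc r" "R \<le> r"
      by (intro that[of "t - Suc T"]) auto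
    then show "max_dist n A (x t) \<le> 2 * \<delta> + e" using bound[of r] R[of r] by simp
  qed
qed

lemma limsup_max_dist_le: "limsup (\<lambda>t. ereal (max_dist n A (x t))) \<le> ereal (2 * \<delta>)"
proof (rule ereal_le_epsilon2)
  fix e :: real assume "0 < e"
  show "limsup (\<lambda>t. ereal (max_dist n A (x t))) \<le> ereal (2 * \<delta>) + ereal e"
    by (rule Limsup_bounded) (use eventually_max_dist_le[OF \<open>0 < e\<close>] in simp)
qed

end

section \<open>From single paths to the almost sure bound\<close>

theorem theorem4p1:
  fixes M :: "'a measure"
    and n l Nc :: nat
    and \<epsilon> \<delta>1 \<delta>2 A :: real
    and V :: "nat \<Rightarrow> nat set"
    and xs :: "nat \<Rightarrow> real"
    and \<xi> :: "nat \<Rightarrow> 'a \<Rightarrow> real"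
    and x :: "nat \<Rightarrow> nat \<Rightarrow> 'a \<Rightarrow> real"
  assumes "prob_space M"
    and "l \<notin> {1..n}"
    and "\<epsilon> > 0"
    and "0 \<le> \<delta>1" and "\<delta>1 \<le> \<delta>2"
    and "prob_space.indep_vars M (\<lambda>_. borel) \<xi> {1..}"
    and "\<And>t. t \<ge> 1 \<Longrightarrow> distributed M lborel (\<xi> t)
           (\<lambda>y. indicator {-\<delta>1..\<delta>2} y / measure lborel {-\<delta>1..\<delta>2})"
    and "\<And>\<omega>. \<omega> \<in> space M \<Longrightarrow> divisive_state n \<epsilon> Nc V xs (\<lambda>i. x 0 i \<omega>)"
    and "1 \<in> V 1"
    and "A > xs Nc + \<epsilon>"
    and "HK_leader_dynamics M n l \<epsilon> A \<xi> x"
    and "0 < \<delta>2" and "\<delta>2 \<le> \<epsilon> / (2 * real n)"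
  shows "AE \<omega> in M. limsup (\<lambda>t. ereal (max_dist n A (\<lambda>i. x t i \<omega>))) \<le> ereal (2 * \<delta>2)"
proof -
  interpret prob_space M by fact
  \<comment> \<open>With \<open>a = - \<delta>1\<close> and \<open>b = \<delta>2\<close>, the
    condition \<open>0 \<le> a + b\<close> is \<open>\<delta>1 \<le> \<delta>2\<close>.\<close>
  have "AE \<omega> in M. \<forall>i\<ge>1. \<xi> i \<omega> \<in> {-\<delta>1..\<delta>2}"
    by (rule uniform_partial_sums_unbounded_above(1)[OF assms(6,7)]) (use assms in auto)
  moreover have "AE \<omega> in M. \<forall>C. \<exists>t. C < (\<Sum>i\<in>{1..t}. \<xi> i \<omega>)"
    by (rule uniform_partial_sums_unbounded_above(2)[OF assms(6,7)]) (use assms in auto)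
  ultimately show ?thesis
    using AE_space
  proof eventually_elim
    case (elim \<omega>)
    have dyn: "x t l \<omega> = A"
      "i \<in> {1..n} \<Longrightarrow> x (Suc t) i \<omega> =
        (\<Sum>j\<in>neighbors n l \<epsilon> (\<lambda>k. x t k \<omega>) i. x t j \<omega>)
          / real (card (neighbors n l \<epsilon> (\<lambda>k. x t k \<omega>) i))
        + (if i = 1 then \<xi> (Suc t) \<omega> else 0)" for t i
      using assms(11) elim(3) unfolding HK_leader_dynamics_def by blast+
    \<comment> \<open>The same inequality turns the asymmetric range into the symmetric bound of the
      locale.\<close>
    have rng: "\<bar>\<xi> t \<omega>\<bar> \<le> \<delta>2" if "1 \<le> t" for t
      using elim(1) that assms(5) by force
    interpret HK_path n l Nc \<epsilon> \<delta>2 A V xs "\<lambda>t. \<xi> t \<omega>" "\<lambda>t i. x t i \<omega>"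
      using assms(2,3,9,10,12,13) assms(8)[OF elim(3)] elim(2) dyn rng
      by unfold_locales auto
    show ?case by (rule limsup_max_dist_le)
  qed
qed

end
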